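(* Suppose $H$ is an $n$-vertex $3$-graph such that $3$ divides $n$, $\delta_2^+(H) \geq \frac{2n}{3} - 1$, and $d_1(v) > 0$ for every $v \in V(H)$. Then $H$ contains a perfect matching.
   Context: A $3$-graph $H=(V,E)$ is a $3$-uniform hypergraph: $V=V(H)$ is a finite vertex set and $E=E(H) \subseteq \binom{V}{3}$ is a set of $3$-element subsets of $V$, called edges. For a vertex $v$, $d_1(v)$ is the number of edges of $H$ containing $v$. For a pair $S\in\binom{V}{2}$, its co-degree $d_2(S)$ is the number of edges of $H$ containing $S$. The minimum positive co-degree $\delta_2^+(H)$ is the largest integer $k$ such that for every $S\in\binom{V}{2}$ either $d_2(S)=0$ or $d_2(S)\ge k$; if $H$ has no edges, $\delta_2^+(H)=0$. A matching in $H$ is a set of pairwise disjoint edges of $H$; it is perfect if every vertex of $H$ lies in (exactly) one of its edges. *)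

theory Defs
  imports Complex_Main "HOL-Library.Ramsey"
begin

definition three_graph :: "'a set \<Rightarrow> 'a set set \<Rightarrow> bool" where
  "three_graph V E \<longleftrightarrow> finite V \<and> E \<subseteq> nsets V 3"

definition vertex_degree :: "'a set set \<Rightarrow> 'a \<Rightarrow> nat" where
  "vertex_degree E v = card {e \<in> E. v \<in> e}"

definition codegree :: "'a set set \<Rightarrow> 'a set \<Rightarrow> nat" where
  "codegree E S = card {e \<in> E. S \<subseteq> e}"

text \<open>If \<open>E\<close> is nonempty and \<open>three_graph V E\<close>, the candidates \<open>k\<close> below are bounded and include \<open>0\<close>, so the greatest one
  exists and taking it over the naturals or over the integers makes no difference. If \<open>E\<close> is empty,
  every \<open>k\<close> is a candidate.\<close>

definition min_pos_codegree :: "'a set \<Rightarrow> 'a set set \<Rightarrow> nat" where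
  "min_pos_codegree V E =
     (if E = {} then 0
      else (GREATEST k. \<forall>S \<in> nsets V 2. codegree E S = 0 \<or> codegree E S \<ge> k))"

definition matching :: "'a set set \<Rightarrow> 'a set set \<Rightarrow> bool" where
  "matching E M \<longleftrightarrow> M \<subseteq> E \<and> pairwise disjnt M"

definition perfect_matching :: "'a set \<Rightarrow> 'a set set \<Rightarrow> 'a set set \<Rightarrow> bool" where
  "perfect_matching V E M \<longleftrightarrow> matching E M \<and> (\<forall>v \<in> V. \<exists>e \<in> M. v \<in> e)"

end

theory Submission
  imports Defs
begin

text \<open>
  Write \<open>n = 3 * m\<close>. A pair of vertices is a shadow pair if some edge contains it; the hypothesis then
  gives it at least \<open>2 * m - 1\<close> completions to an edge (\<open>pair_nbrs\<close>). Since every vertex lies in an edge,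
  every vertex has at least \<open>2 * m\<close> neighbours in the shadow graph (\<open>shadow_degree\<close>).

  Take a maximum matching \<open>M\<close>, let \<open>U\<close> be the set of vertices that it misses, and suppose that \<open>U\<close> is
  nonempty. Then \<open>card U \<ge> 3\<close>, and \<open>U\<close> contains no edge. The engine is \<open>three_pairs_inner_degree\<close>: if
  \<open>f\<close> is a matching edge, then three disjoint shadow pairs inside \<open>U \<union> f\<close> have together at least
  \<open>2 * card U + 3\<close> completions inside \<open>U \<union> f\<close>. Otherwise their completions are so numerous on the other
  matching edges that one of these, say \<open>g\<close>, contains distinct completions of the three pairs, and then
  \<open>f\<close> and \<open>g\<close> can be traded for three edges. On the other hand, maximality makes completions inside
  \<open>U \<union> f\<close> rare, because \<open>U \<union> f\<close> cannot contain two disjoint edges.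

  This is used twice. Suppose first that \<open>U\<close> contains a shadow pair \<open>{x, y}\<close>, and let \<open>z\<close> be a third vertex
  of \<open>U\<close>. On each matching edge \<open>f\<close>, count the completions of \<open>{x, y}\<close> and the shadow neighbours of \<open>z\<close>.
  By degree counting some \<open>f\<close> has total at least 5, hence meets the two sets in at least 3 and 2, or 2 and
  3, vertices; the engine excludes both cases, applied to \<open>{x, y}\<close>, a pair joining \<open>z\<close> to \<open>f\<close>, and the
  remaining pair of \<open>f\<close>. So \<open>U\<close> is independent in the shadow (\<open>U_independent\<close>).

  Then all shadow neighbours of three vertices of \<open>U\<close> lie on matching edges, and by counting there is an
  \<open>f\<close> in \<open>M\<close> whose three vertices can be paired off with them. The engine demands at least 9 completions of
  these pairs in \<open>U \<union> f\<close>; but no completion lies in \<open>U\<close>, and \<open>f\<close> leaves room for only 6 (\<open>U_empty\<close>).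
\<close>

section \<open>Completions of pairs and the shadow graph\<close>

definition pair_nbrs :: "'a set set \<Rightarrow> 'a \<Rightarrow> 'a \<Rightarrow> 'a set" where
  "pair_nbrs E x y = {z. {x, y, z} \<in> E}"

definition shadow_nbrs :: "'a set set \<Rightarrow> 'a \<Rightarrow> 'a set" where
  "shadow_nbrs E x = {y. pair_nbrs E x y \<noteq> {}}"

lemma card_Int_triple:
  assumes "a \<noteq> b" "a \<noteq> c" "b \<noteq> c"
  shows "card (A \<inter> {a, b, c}) = of_bool (a \<in> A) + of_bool (b \<in> A) + of_bool (c \<in> A)"
  using assms by (auto simp: Int_insert_right)

text \<open>Hall's condition for three subsets of a three-element set: if the sizes sum to at least 7, then no
  set is empty, some set is everything, and any two sets cover at least two elements.\<close>

lemma distinct_representatives_triple: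
  assumes "card g = 3"
    and "card (A \<inter> g) + card (B \<inter> g) + card (C \<inter> g) \<ge> 7"
  obtains a b c where "a \<in> A" "b \<in> B" "c \<in> C" "g = {a, b, c}" "a \<noteq> b" "a \<noteq> c" "b \<noteq> c"
proof -
  obtain p q r where g: "g = {p, q, r}" and d: "p \<noteq> q" "p \<noteq> r" "q \<noteq> r"
    using assms(1) by (auto simp: card_3_iff)
  have "(p \<in> A \<and> q \<in> B \<and> r \<in> C) \<or> (p \<in> A \<and> r \<in> B \<and> q \<in> C)
      \<or> (q \<in> A \<and> p \<in> B \<and> r \<in> C) \<or> (q \<in> A \<and> r \<in> B \<and> p \<in> C)
      \<or> (r \<in> A \<and> p \<in> B \<and> q \<in> C) \<or> (r \<in> A \<and> q \<in> B \<and> p \<in> C)"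
    using assms(2) unfolding g card_Int_triple[OF d]
    by (cases "p \<in> A"; cases "q \<in> A"; cases "r \<in> A";
        cases "p \<in> B"; cases "q \<in> B"; cases "r \<in> B";
        cases "p \<in> C"; cases "q \<in> C"; cases "r \<in> C"; simp)
  moreover have "g = {p, r, q}" "g = {q, p, r}" "g = {q, r, p}" "g = {r, p, q}" "g = {r, q, p}"
    using g by auto
  ultimately show thesis
    using that g d by (elim disjE conjE) metis+
qed

lemma min_pos_codegree_le_card_pair_nbrs:
  assumes "three_graph V E" and "pair_nbrs E x y \<noteq> {}"
  shows "min_pos_codegree V E \<le> card (pair_nbrs E x y)"
proof -
  obtain z where z: "{x, y, z} \<in> E"
    using assms(2) by (auto simp: pair_nbrs_def)
  have fin: "finite V" and sub: "E \<subseteq> nsets V 3"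
    using assms(1) by (auto simp: three_graph_def)
  have finE: "finite E"
    using finite_subset[OF sub] finite_imp_finite_nsets[OF fin] by blast
  have "{x, y, z} \<subseteq> V" "card {x, y, z} = 3"
    using z sub by (auto simp: nsets_def)
  then have d: "x \<noteq> y" and xy: "{x, y} \<in> nsets V 2"
    by (auto simp: nsets_def card_insert_if split: if_splits)
  have bij: "bij_betw (\<lambda>z. {x, y, z}) (pair_nbrs E x y) {e \<in> E. {x, y} \<subseteq> e}"
  proof (rule bij_betwI')
    fix u v assume "u \<in> pair_nbrs E x y" "v \<in> pair_nbrs E x y"
    then have "card {x, y, u} = 3" "card {x, y, v} = 3"
      using sub by (auto simp: nsets_def pair_nbrs_def)
    then show "({x, y, u} = {x, y, v}) = (u = v)"
      by (auto simp: card_insert_if split: if_splits)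
  next
    fix u assume "u \<in> pair_nbrs E x y"
    then show "{x, y, u} \<in> {e \<in> E. {x, y} \<subseteq> e}" by (auto simp: pair_nbrs_def)
  next
    fix e assume e: "e \<in> {e \<in> E. {x, y} \<subseteq> e}"
    then have "card e = 3" using sub by (auto simp: nsets_def)
    then obtain p q r where "e = {p, q, r}" by (auto simp: card_3_iff)
    then have "\<exists>u. e = {x, y, u}" using e d by auto
    then show "\<exists>u\<in>pair_nbrs E x y. e = {x, y, u}"
      using e by (auto simp: pair_nbrs_def)
  qed
  have cod: "codegree E {x, y} = card (pair_nbrs E x y)"
    unfolding codegree_def using bij_betw_same_card[OF bij] by simp
  have "finite {e \<in> E. {x, y} \<subseteq> e}" using finE by simp
  then have pos: "codegree E {x, y} \<noteq> 0"
    unfolding codegree_def using z by (auto simp: card_eq_0_iff)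
  let ?P = "\<lambda>k. \<forall>S\<in>nsets V 2. codegree E S = 0 \<or> codegree E S \<ge> k"
  have "?P (GREATEST k. ?P k)"
  proof (rule GreatestI_nat)
    show "?P 0" by simp
    show "k \<le> codegree E {x, y}" if "?P k" for k
      using bspec[OF that xy] pos by simp
  qed
  then have "?P (min_pos_codegree V E)"
    using z unfolding min_pos_codegree_def by auto
  then show ?thesis
    using bspec[OF _ xy, of "\<lambda>S. codegree E S = 0 \<or> min_pos_codegree V E \<le> codegree E S"]
      pos cod by simp
qed

section \<open>Local changes to a maximum matching\<close>

locale maximum_matching =
  fixes V :: "'a set" and E :: "'a set set" and m :: nat and M :: "'a set set"
  assumes graph: "three_graph V E"
    and card_V: "card V = 3 * m"
    and pair_degree: "\<And>x y. pair_nbrs E x y \<noteq> {} \<Longrightarrow> 2 * m \<le> card (pair_nbrs E x y) + 1"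
    and covered: "\<And>v. v \<in> V \<Longrightarrow> \<exists>e\<in>E. v \<in> e"
    and matching: "matching E M"
    and maximum: "\<And>M'. matching E M' \<Longrightarrow> card M' \<le> card M"
begin

abbreviation N :: "'a \<Rightarrow> 'a \<Rightarrow> 'a set" where
  "N \<equiv> pair_nbrs E"

abbreviation G :: "'a \<Rightarrow> 'a set" where
  "G \<equiv> shadow_nbrs E"

definition U :: "'a set" where
  "U = V - \<Union> M"

lemma finite_V: "finite V"
  using graph by (simp add: three_graph_def)

lemma edge_card: "e \<in> E \<Longrightarrow> card e = 3" and edge_subset: "e \<in> E \<Longrightarrow> e \<subseteq> V"
  using graph by (auto simp: three_graph_def nsets_def)

lemma finite_E: "finite E"
  using finite_subset[of E "Pow V"] finite_V edge_subset by auto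

lemma M_edges: "M \<subseteq> E"
  using matching by (simp add: matching_def)

lemma finite_M: "finite M"
  using finite_subset[OF M_edges finite_E] .

lemma M_disjoint: "e \<in> M \<Longrightarrow> f \<in> M \<Longrightarrow> e \<noteq> f \<Longrightarrow> e \<inter> f = {}"
  using matching by (auto simp: matching_def pairwise_def disjnt_def)

lemma finite_U: "finite U"
  using finite_V by (simp add: U_def)

lemma N_D: "z \<in> N x y \<Longrightarrow> {x, y, z} \<in> E \<and> x \<noteq> y \<and> x \<noteq> z \<and> y \<noteq> z \<and> z \<in> V"
  using edge_card[of "{x, y, z}"] edge_subset[of "{x, y, z}"]
  by (auto simp: pair_nbrs_def card_insert_if split: if_splits)

lemma N_swap: "z \<in> N x y \<longleftrightarrow> y \<in> N x z"
  by (simp add: pair_nbrs_def insert_commute)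

lemma G_I: "z \<in> N x y \<Longrightarrow> y \<in> G x"
  by (auto simp: shadow_nbrs_def)

lemma G_edge: "e \<in> E \<Longrightarrow> x \<in> e \<Longrightarrow> y \<in> e \<Longrightarrow> x \<noteq> y \<Longrightarrow> y \<in> G x"
proof -
  assume a: "e \<in> E" "x \<in> e" "y \<in> e" "x \<noteq> y"
  obtain p q r where "e = {p, q, r}" using edge_card[OF a(1)] by (auto simp: card_3_iff)
  then have "\<exists>z. e = {x, y, z}" using a by auto
  then show ?thesis using a(1) by (auto simp: shadow_nbrs_def pair_nbrs_def)
qed

lemma N_subset: "N x y \<subseteq> V"
  using N_D by blast

lemma G_subset: "G x \<subseteq> V"
proof
  fix y assume "y \<in> G x"
  then obtain z where "{x, y, z} \<in> E" by (auto simp: shadow_nbrs_def pair_nbrs_def)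
  then show "y \<in> V" using edge_subset by auto
qed

text \<open>If \<open>{v, x}\<close> is a shadow pair, then \<open>x\<close> is a neighbour of \<open>v\<close>, and so is each of the at least
  \<open>2 * m - 1\<close> completions of \<open>{v, x}\<close>.\<close>

lemma shadow_degree:
  assumes "v \<in> V"
  shows "2 * m \<le> card (G v)"
proof -
  obtain e where e: "e \<in> E" "v \<in> e" using covered[OF assms] by blast
  then obtain x where x: "x \<in> e" "x \<noteq> v"
    using edge_card[of e] by (auto simp: card_3_iff)
  have Nx: "N v x \<noteq> {}"
    using G_edge[of e v x] e x by (auto simp: shadow_nbrs_def)
  have "insert x (N v x) \<subseteq> G v"
  proof -
    have "x \<in> G v" using Nx by (simp add: shadow_nbrs_def)
    moreover have "y \<in> G v" if "y \<in> N v x" for y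
      using that N_swap[of y v x] G_I by metis
    ultimately show ?thesis by blast
  qed
  moreover have "x \<notin> N v x" using N_D by blast
  moreover have "finite (G v)" "finite (N v x)"
    using finite_subset[OF G_subset finite_V] finite_subset[OF N_subset finite_V] by simp_all
  ultimately have "card (N v x) + 1 \<le> card (G v)"
    using card_mono[of "G v" "insert x (N v x)"] by simp
  then show ?thesis using pair_degree[OF Nx] by simp
qed

lemma card_split:
  assumes "A \<subseteq> V"
  shows "card A = card (A \<inter> U) + (\<Sum>g\<in>M. card (A \<inter> g))"
proof -
  have finA: "finite A" using finite_subset[OF assms finite_V] .
  have "card A = card ((A \<inter> U) \<union> (\<Union>g\<in>M. A \<inter> g))"
    using assms by (intro arg_cong[of _ _ card]) (auto simp: U_def)
  also have "\<dots> = card (A \<inter> U) + card (\<Union>g\<in>M. A \<inter> g)"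
    using finA finite_M by (intro card_Un_disjoint) (auto simp: U_def)
  also have "card (\<Union>g\<in>M. A \<inter> g) = (\<Sum>g\<in>M. card (A \<inter> g))"
    using finite_M finA M_disjoint by (intro card_UN_disjoint) auto
  finally show ?thesis .
qed

lemma card_U: "card U + 3 * card M = 3 * m"
proof -
  have "(\<Sum>g\<in>M. card (V \<inter> g)) = (\<Sum>g\<in>M. 3)"
    using M_edges edge_card edge_subset by (intro sum.cong) (auto simp: Int_absorb1 subset_iff)
  moreover have "V \<inter> U = U" by (auto simp: U_def)
  ultimately show ?thesis using card_split[of V] card_V by simp
qed

text \<open>Exchanging \<open>K\<close> for \<open>L\<close> gives another matching, which cannot be larger than \<open>M\<close>.\<close>

lemma no_augmentation:
  assumes "K \<subseteq> M" and "L \<subseteq> E" and "pairwise disjnt L" and "\<Union> L \<subseteq> U \<union> \<Union> K"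
  shows "card L \<le> card K"
proof -
  have sep: "disjnt e f" if "e \<in> L" "f \<in> M - K" for e f
  proof -
    have "f \<inter> U = {}" using that by (auto simp: U_def)
    moreover have "f \<inter> \<Union> K = {}" using that assms(1) M_disjoint by blast
    ultimately show ?thesis using that(1) assms(4) unfolding disjnt_def by blast
  qed
  have "pairwise disjnt ((M - K) \<union> L)"
    unfolding pairwise_def
  proof (intro ballI impI)
    fix e f assume ef: "e \<in> M - K \<union> L" "f \<in> M - K \<union> L" "e \<noteq> f"
    then consider "e \<in> M - K" "f \<in> M - K" | "e \<in> L" "f \<in> L" | "e \<in> L" "f \<in> M - K"
      | "e \<in> M - K" "f \<in> L" by blast
    then show "disjnt e f"
    proof cases
      case 1
      then show ?thesis using M_disjoint ef(3) by (simp add: disjnt_def)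
    next
      case 2
      then show ?thesis using assms(3) ef(3) by (simp add: pairwise_def)
    next
      case 3
      then show ?thesis by (rule sep)
    next
      case 4
      then show ?thesis using sep disjnt_sym by blast
    qed
  qed
  then have "card ((M - K) \<union> L) \<le> card M"
    using M_edges assms(2) by (intro maximum) (auto simp: matching_def)
  moreover have "(M - K) \<inter> L = {}"
  proof (rule ccontr)
    assume "(M - K) \<inter> L \<noteq> {}"
    then obtain e where "e \<in> M - K" "e \<in> L" by blast
    then have "e = {}" "e \<in> E" using sep[of e e] M_edges by auto
    then show False using edge_card[of e] by simp
  qed
  moreover have "finite L" using assms(2) finite_E finite_subset by blast
  moreover have "card (M - K) + card K = card M"
    using assms(1) finite_M by (metis card_Diff_subset card_mono finite_subset le_add_diff_inverse2)
  ultimately show ?thesis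
    using card_Un_disjoint[of "M - K" L] finite_M by simp
qed

lemma no_edge_in_U: "e \<in> E \<Longrightarrow> \<not> e \<subseteq> U"
  using no_augmentation[of "{}" "{e}"] by auto

lemma no_two_edges:
  assumes "f \<in> M" "e \<in> E" "e' \<in> E" "e \<inter> e' = {}" "e \<union> e' \<subseteq> U \<union> f"
  shows False
proof -
  have "e \<noteq> e'" using assms edge_card[of e] by auto
  then have "card {e, e'} = 2" by simp
  moreover have "pairwise disjnt {e, e'}"
    using assms(4) by (auto simp: pairwise_insert disjnt_def)
  ultimately show False
    using no_augmentation[of "{f}" "{e, e'}"] assms by simp
qed

lemma no_three_edges:
  assumes "f \<in> M" "g \<in> M" "e1 \<in> E" "e2 \<in> E" "e3 \<in> E"
    and "e1 \<inter> e2 = {}" "e1 \<inter> e3 = {}" "e2 \<inter> e3 = {}" "e1 \<union> e2 \<union> e3 \<subseteq> U \<union> f \<union> g"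
  shows False
proof -
  have "e1 \<noteq> e2" "e1 \<noteq> e3" "e2 \<noteq> e3"
    using assms edge_card[of e1] edge_card[of e2] by auto
  then have "card {e1, e2, e3} = 3" by simp
  moreover have "pairwise disjnt {e1, e2, e3}"
    using assms by (auto simp: pairwise_insert disjnt_def)
  moreover have "card {f, g} \<le> 2" by (simp add: card_insert_if)
  moreover have "card {e1, e2, e3} \<le> card {f, g}"
  proof (rule no_augmentation)
    show "{f, g} \<subseteq> M" "{e1, e2, e3} \<subseteq> E" using assms by simp_all
    show "pairwise disjnt {e1, e2, e3}" by fact
    show "\<Union> {e1, e2, e3} \<subseteq> U \<union> \<Union> {f, g}" using assms(9) by blast
  qed
  ultimately show False by linarith
qed

text \<open>The three pairs have at least \<open>6 * m - 3\<close> completions in total. A matching edge \<open>g\<close> other than \<open>f\<close>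
  accounts for at most 6 of them, since with 7 there would be distinct representatives on \<open>g\<close>, and the three
  resulting edges could replace \<open>f\<close> and \<open>g\<close>. As \<open>3 * m = card U + 3 * card M\<close>, this leaves
  \<open>6 * m - 3 - 6 * (card M - 1) = 2 * card U + 3\<close> completions for \<open>U \<union> f\<close>.\<close>

lemma three_pairs_inner_degree:
  assumes f: "f \<in> M" and dist: "distinct [x1, y1, x2, y2, x3, y3]"
    and inside: "{x1, y1, x2, y2, x3, y3} \<subseteq> U \<union> f"
    and shadow: "y1 \<in> G x1" "y2 \<in> G x2" "y3 \<in> G x3"
  shows "2 * card U + 3 \<le> card (N x1 y1 \<inter> (U \<union> f)) + card (N x2 y2 \<inter> (U \<union> f))
           + card (N x3 y3 \<inter> (U \<union> f))"
proof -
  have few: "card (N x1 y1 \<inter> g) + card (N x2 y2 \<inter> g) + card (N x3 y3 \<inter> g) \<le> 6"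
    if g: "g \<in> M - {f}" for g
  proof (rule ccontr)
    assume "\<not> ?thesis"
    then have seven: "card (N x1 y1 \<inter> g) + card (N x2 y2 \<inter> g) + card (N x3 y3 \<inter> g) \<ge> 7"
      by simp
    have "card g = 3" using g M_edges edge_card by blast
    from distinct_representatives_triple[OF this seven]
    obtain a b c where abc: "a \<in> N x1 y1" "b \<in> N x2 y2" "c \<in> N x3 y3" "g = {a, b, c}"
      "a \<noteq> b" "a \<noteq> c" "b \<noteq> c" by blast
    have "g \<inter> (U \<union> f) = {}"
      using g f M_disjoint[of g f] by (auto simp: U_def)
    then have out: "a \<notin> U \<union> f" "b \<notin> U \<union> f" "c \<notin> U \<union> f"
      using abc(4) by auto
    show False
    proof (rule no_three_edges)
      show "f \<in> M" "g \<in> M" using f g by auto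
      show "{x1, y1, a} \<in> E" "{x2, y2, b} \<in> E" "{x3, y3, c} \<in> E"
        using abc by (auto simp: pair_nbrs_def)
      show "{x1, y1, a} \<inter> {x2, y2, b} = {}" "{x1, y1, a} \<inter> {x3, y3, c} = {}"
        "{x2, y2, b} \<inter> {x3, y3, c} = {}"
        using dist abc out inside by auto
      show "{x1, y1, a} \<union> {x2, y2, b} \<union> {x3, y3, c} \<subseteq> U \<union> f \<union> g"
        using inside abc(4) by auto
    qed
  qed
  have split: "card (N x y) = card (N x y \<inter> (U \<union> f)) + (\<Sum>g\<in>M - {f}. card (N x y \<inter> g))"
    for x y
  proof -
    have "card (N x y \<inter> (U \<union> f)) = card (N x y \<inter> U) + card (N x y \<inter> f)"
    proof -
      have "finite (N x y)" using N_subset finite_V finite_subset by blast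
      moreover have "(N x y \<inter> U) \<inter> (N x y \<inter> f) = {}" using f by (auto simp: U_def)
      ultimately show ?thesis
        by (simp add: Int_Un_distrib card_Un_disjoint)
    qed
    moreover have "(\<Sum>g\<in>M. card (N x y \<inter> g))
        = card (N x y \<inter> f) + (\<Sum>g\<in>M - {f}. card (N x y \<inter> g))"
      using sum.remove[OF finite_M f] .
    ultimately show ?thesis using card_split[OF N_subset, of x y] by simp
  qed
  have "(\<Sum>g\<in>M - {f}. card (N x1 y1 \<inter> g)) + (\<Sum>g\<in>M - {f}. card (N x2 y2 \<inter> g))
      + (\<Sum>g\<in>M - {f}. card (N x3 y3 \<inter> g)) \<le> 6 * card (M - {f})"
    using sum_bounded_above[of "M - {f}" "\<lambda>g. card (N x1 y1 \<inter> g) + card (N x2 y2 \<inter> g)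
      + card (N x3 y3 \<inter> g)" 6] few by (simp add: sum.distrib)
  moreover have "card (M - {f}) + 1 = card M"
    using f finite_M by (metis Suc_eq_plus1 card_Suc_Diff1)
  moreover have "2 * m \<le> card (N x1 y1) + 1" "2 * m \<le> card (N x2 y2) + 1"
    "2 * m \<le> card (N x3 y3) + 1"
    using shadow pair_degree by (auto simp: shadow_nbrs_def)
  ultimately show ?thesis
    using split[of x1 y1] split[of x2 y2] split[of x3 y3] card_U by linarith
qed

section \<open>The uncovered vertices are independent in the shadow\<close>

text \<open>If \<open>c\<close> were a neighbour of \<open>z\<close>, the pairs \<open>{x, y}\<close>, \<open>{a, b}\<close> and \<open>{z, c}\<close> would have too few
  completions in \<open>U \<union> f\<close>. Indeed \<open>{x, y}\<close> has only \<open>a\<close>, \<open>b\<close>, \<open>c\<close>; the edge \<open>{x, y, c}\<close> forces the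
  completions of \<open>{a, b}\<close> into \<open>{x, y, c}\<close>; and completions of \<open>{a, b}\<close> in \<open>{x, y}\<close> compete with those of
  \<open>{z, c}\<close> in \<open>U\<close>, as distinct ones would give two disjoint edges.\<close>

lemma pair_in_U_full_edge:
  assumes xyz: "x \<in> U" "y \<in> U" "z \<in> U" "z \<noteq> x" "z \<noteq> y" and xy: "y \<in> G x"
    and f: "f \<in> M" "f \<subseteq> N x y" and c: "c \<in> f"
  shows "c \<notin> G z"
proof
  assume zc: "c \<in> G z"
  have fE: "f \<in> E" using f M_edges by blast
  obtain a b where ab: "f = {a, b, c}" "a \<noteq> b" "a \<noteq> c" "b \<noteq> c"
  proof -
    obtain p q r where "f = {p, q, r}" "p \<noteq> q" "p \<noteq> r" "q \<noteq> r"
      using edge_card[OF fE] by (auto simp: card_3_iff)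
    then show thesis using c that by (cases "c = p"; cases "c = q") (auto simp: insert_commute)
  qed
  have fU: "f \<inter> U = {}" using f by (auto simp: U_def)
  have xny: "x \<noteq> y" using f(2) c N_D by blast
  have xya: "{x, y, a} \<in> E" "{x, y, b} \<in> E" "{x, y, c} \<in> E"
    using f(2) ab by (auto simp: pair_nbrs_def)
  have out: "a \<notin> U" "b \<notin> U" "c \<notin> U" using fU ab by auto
  have inner: "2 * card U + 3 \<le> card (N x y \<inter> (U \<union> f)) + card (N a b \<inter> (U \<union> f))
      + card (N z c \<inter> (U \<union> f))"
  proof (rule three_pairs_inner_degree[OF f(1)])
    show "distinct [x, y, a, b, z, c]" using xyz xny ab out by auto
    show "{x, y, a, b, z, c} \<subseteq> U \<union> f" using xyz ab by auto
    show "b \<in> G a" using G_edge[OF fE] ab by auto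
  qed (use xy zc in auto)
  have Nxy: "N x y \<inter> (U \<union> f) \<subseteq> {a, b, c}"
    using xyz no_edge_in_U ab(1) by (auto simp: pair_nbrs_def)
  have Nab: "N a b \<inter> (U \<union> f) \<subseteq> {x, y, c}"
  proof
    fix u assume u: "u \<in> N a b \<inter> (U \<union> f)"
    then have e: "{a, b, u} \<in> E" "u \<noteq> a" "u \<noteq> b" using N_D by blast+
    show "u \<in> {x, y, c}"
      using no_two_edges[OF f(1) e(1) xya(3)] u e ab xyz out by auto
  qed
  have conflict: False if "u \<in> N a b" "v \<in> N z c" "u \<noteq> v" "u \<in> {x, y}" "v \<in> U" for u v
  proof -
    have e: "{a, b, u} \<in> E" "{z, c, v} \<in> E" using that by (auto simp: pair_nbrs_def)
    show False
      using no_two_edges[OF f(1) e] that ab xyz out by auto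
  qed
  have c3: "card (N x y \<inter> (U \<union> f)) \<le> 3"
    using card_mono[OF _ Nxy] ab by simp
  have U3: "{x, y, z} \<subseteq> U" "card {x, y, z} = 3" using xyz xny by auto
  then have cU: "3 \<le> card U" using card_mono[OF finite_U U3(1)] by simp
  have Nzc: "N z c \<inter> (U \<union> f) \<subseteq> {a, b} \<union> (N z c \<inter> (U - {z}))"
    using N_D ab by auto
  \<comment> \<open>The counts for \<open>{x, y}\<close>, \<open>{a, b}\<close>, \<open>{z, c}\<close> are at most 3, 1, \<open>card U + 1\<close> if no completion of
    \<open>{a, b}\<close> lies in \<open>{x, y}\<close>, and otherwise at most 3, 3, 2 or 3, 2, 3.\<close>
  show False
  proof (cases "\<exists>u\<in>{x, y}. u \<in> N a b")
    case False
    then have "N a b \<inter> (U \<union> f) \<subseteq> {c}" using Nab by auto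
    then have "card (N a b \<inter> (U \<union> f)) \<le> 1" using card_mono[of "{c}"] by simp
    moreover have "N z c \<inter> (U \<union> f) \<subseteq> {a, b} \<union> (U - {z})" using Nzc by auto
    then have "card (N z c \<inter> (U \<union> f)) \<le> card ({a, b} \<union> (U - {z}))"
      using finite_U by (intro card_mono) auto
    moreover have "card ({a, b} \<union> (U - {z})) \<le> 2 + (card U - 1)"
      using card_Un_le[of "{a, b}" "U - {z}"] ab xyz finite_U by simp
    ultimately show False using inner c3 cU by linarith
  next
    case True
    then obtain u where u: "u \<in> {x, y}" "u \<in> N a b" by blast
    show False
    proof (cases "N z c \<inter> (U - {z}) = {}")
      case True
      then have "card (N z c \<inter> (U \<union> f)) \<le> card {a, b}" using Nzc by (intro card_mono) auto
      moreover have "card (N a b \<inter> (U \<union> f)) \<le> card {x, y, c}" using Nab by (intro card_mono) auto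
      moreover have "card {x, y, c} \<le> 3" "card {a, b} \<le> 2" by (simp_all add: card_insert_if)
      ultimately show False using inner c3 cU by linarith
    next
      case False
      then obtain v where v: "v \<in> N z c" "v \<in> U" by blast
      have "N a b \<inter> (U \<union> f) \<subseteq> {v, c}" using Nab conflict[OF _ v(1)] v(2) by blast
      then have "card (N a b \<inter> (U \<union> f)) \<le> card {v, c}" by (intro card_mono) auto
      moreover have "N z c \<inter> (U \<union> f) \<subseteq> {a, b, u}" using Nzc conflict[OF u(2) _ _ u(1)] by blast
      then have "card (N z c \<inter> (U \<union> f)) \<le> card {a, b, u}" by (intro card_mono) auto
      moreover have "card {v, c} \<le> 2" "card {a, b, u} \<le> 3" by (simp_all add: card_insert_if)
      ultimately show False using inner c3 cU by linarith
    qed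
  qed
qed

text \<open>Since \<open>z\<close> is adjacent to all of \<open>f\<close>, it can be paired with one of the two completions \<open>a\<close>, \<open>b\<close> of
  \<open>{x, y}\<close> on \<open>f\<close>. The count for \<open>{x, y}\<close>, \<open>{b, c}\<close> and \<open>{z, a}\<close> is then again too small: the edge
  \<open>{x, y, a}\<close> confines the completions of \<open>{b, c}\<close> to \<open>{x, y, a}\<close>, the edge \<open>{x, y, b}\<close> keeps \<open>c\<close> from
  completing \<open>{z, a}\<close>, and completions of \<open>{b, c}\<close> in \<open>{x, y}\<close> compete with those of \<open>{z, a}\<close> in \<open>U\<close>.\<close>

lemma pair_in_U_adjacent_edge:
  assumes xyz: "x \<in> U" "y \<in> U" "z \<in> U" "z \<noteq> x" "z \<noteq> y" and xy: "y \<in> G x"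
    and f: "f \<in> M" "f \<subseteq> G z"
  shows "card (N x y \<inter> f) \<noteq> 2"
proof
  assume two: "card (N x y \<inter> f) = 2"
  have fE: "f \<in> E" using f M_edges by blast
  obtain a b where Nf: "N x y \<inter> f = {a, b}" and anb: "a \<noteq> b" using two by (auto simp: card_2_iff)
  obtain c where ab: "f = {a, b, c}" "a \<noteq> c" "b \<noteq> c"
  proof -
    obtain p q r where "f = {p, q, r}" "p \<noteq> q" "p \<noteq> r" "q \<noteq> r"
      using edge_card[OF fE] by (auto simp: card_3_iff)
    moreover have "a \<in> f" "b \<in> f" using Nf by auto
    ultimately show thesis using anb that
      by (cases "a = p"; cases "a = q"; cases "b = p"; cases "b = q") (auto simp: insert_commute)
  qed
  have fU: "f \<inter> U = {}" using f by (auto simp: U_def)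
  have xya: "{x, y, a} \<in> E" "{x, y, b} \<in> E"
    using Nf by (auto simp: pair_nbrs_def)
  then have xny: "x \<noteq> y" using N_D[of a x y] by (auto simp: pair_nbrs_def)
  have out: "a \<notin> U" "b \<notin> U" "c \<notin> U" using fU ab by auto
  have inner: "2 * card U + 3 \<le> card (N x y \<inter> (U \<union> f)) + card (N b c \<inter> (U \<union> f))
      + card (N z a \<inter> (U \<union> f))"
  proof (rule three_pairs_inner_degree[OF f(1)])
    show "distinct [x, y, b, c, z, a]" using xyz xny anb ab out by auto
    show "{x, y, b, c, z, a} \<subseteq> U \<union> f" using xyz ab by auto
    show "c \<in> G b" using G_edge[OF fE] ab by auto
    show "a \<in> G z" using f ab by auto
  qed (use xy in auto)
  have "N x y \<inter> U = {}" using xyz no_edge_in_U by (auto simp: pair_nbrs_def)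
  then have c2: "card (N x y \<inter> (U \<union> f)) = 2" using two by (simp add: Int_Un_distrib)
  have Nbc: "N b c \<inter> (U \<union> f) \<subseteq> {x, y, a}"
  proof
    fix u assume u: "u \<in> N b c \<inter> (U \<union> f)"
    then have e: "{b, c, u} \<in> E" "u \<noteq> b" "u \<noteq> c" using N_D by blast+
    show "u \<in> {x, y, a}"
      using no_two_edges[OF f(1) e(1) xya(1)] u e ab anb xyz out by auto
  qed
  have Nza: "N z a \<inter> (U \<union> f) \<subseteq> {b} \<union> (N z a \<inter> (U - {z}))"
  proof
    fix u assume u: "u \<in> N z a \<inter> (U \<union> f)"
    then have e: "{z, a, u} \<in> E" "u \<noteq> z" "u \<noteq> a" using N_D by blast+
    have "u \<noteq> c"
      using no_two_edges[OF f(1) e(1) xya(2)] ab anb xyz out by auto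
    then show "u \<in> {b} \<union> (N z a \<inter> (U - {z}))" using u e ab by auto
  qed
  have conflict: False if "u \<in> N b c" "v \<in> N z a" "u \<noteq> v" "u \<in> {x, y}" "v \<in> U" for u v
  proof -
    have e: "{b, c, u} \<in> E" "{z, a, v} \<in> E" using that by (auto simp: pair_nbrs_def)
    show False
      using no_two_edges[OF f(1) e] that ab anb xyz out by auto
  qed
  have U3: "{x, y, z} \<subseteq> U" "card {x, y, z} = 3" using xyz xny by auto
  then have cU: "3 \<le> card U" using card_mono[OF finite_U U3(1)] by simp
  \<comment> \<open>The counts for \<open>{x, y}\<close>, \<open>{b, c}\<close>, \<open>{z, a}\<close> are at most 2, 1, \<open>card U\<close> or 2, 3, 2.\<close>
  show False
  proof (cases "\<exists>u\<in>{x, y}. u \<in> N b c")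
    case False
    then have "N b c \<inter> (U \<union> f) \<subseteq> {a}" using Nbc by auto
    then have "card (N b c \<inter> (U \<union> f)) \<le> 1" using card_mono[of "{a}"] by simp
    moreover have "N z a \<inter> (U \<union> f) \<subseteq> {b} \<union> (U - {z})" using Nza by auto
    then have "card (N z a \<inter> (U \<union> f)) \<le> card ({b} \<union> (U - {z}))"
      using finite_U by (intro card_mono) auto
    moreover have "card ({b} \<union> (U - {z})) \<le> 1 + (card U - 1)"
      using card_Un_le[of "{b}" "U - {z}"] xyz finite_U by simp
    ultimately show False using inner c2 cU by linarith
  next
    case True
    then obtain u where u: "u \<in> {x, y}" "u \<in> N b c" by blast
    then have "N z a \<inter> (U \<union> f) \<subseteq> {b, u}" using Nza conflict[OF u(2) _ _ u(1)] by blast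
    then have "card (N z a \<inter> (U \<union> f)) \<le> card {b, u}" by (intro card_mono) auto
    moreover have "card (N b c \<inter> (U \<union> f)) \<le> card {x, y, a}" using Nbc by (intro card_mono) auto
    moreover have "card {x, y, a} \<le> 3" "card {b, u} \<le> 2" by (simp_all add: card_insert_if)
    ultimately show False using inner c2 cU by linarith
  qed
qed

text \<open>By the two preceding lemmas a matching edge carries at most 4 of the completions of \<open>{x, y}\<close> and
  neighbours of \<open>z\<close>. No completion of \<open>{x, y}\<close> lies in \<open>U\<close>, so at least
  \<open>(2 * m - 1) + 2 * m - 4 * card M\<close> neighbours of \<open>z\<close> do. As \<open>3 * m = card U + 3 * card M\<close>, this is
  \<open>4 / 3 * card U - 1 \<ge> card U\<close>, whereas \<open>z\<close> has at most \<open>card U - 1\<close> neighbours in \<open>U\<close>.\<close>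

lemma U_independent:
  assumes x: "x \<in> U" and y: "y \<in> U"
  shows "y \<notin> G x"
proof
  assume xy: "y \<in> G x"
  then have xny: "x \<noteq> y" using N_D by (auto simp: shadow_nbrs_def)
  have "{x, y} \<subseteq> U" "card {x, y} = 2" using x y xny by auto
  then have "2 \<le> card U" using card_mono[OF finite_U, of "{x, y}"] by simp
  then have "3 \<le> card U" using card_U by presburger
  have "\<not> U \<subseteq> {x, y}"
  proof
    assume "U \<subseteq> {x, y}"
    then have "card U \<le> card {x, y}" by (intro card_mono) auto
    then show False using \<open>3 \<le> card U\<close> \<open>card {x, y} = 2\<close> by simp
  qed
  then obtain z where z: "z \<in> U" "z \<noteq> x" "z \<noteq> y" by blast
  have le4: "card (N x y \<inter> f) + card (G z \<inter> f) \<le> 4" if f: "f \<in> M" for f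
  proof -
    have c3: "card f = 3" using f M_edges edge_card by blast
    then have finf: "finite f" by (auto intro: card_ge_0_finite)
    have le3: "card (N x y \<inter> f) \<le> 3" "card (G z \<inter> f) \<le> 3"
      using card_mono[OF finf] c3 by (metis Int_lower2)+
    have full: "A \<inter> f = f" if "card (A \<inter> f) = 3" for A
      using card_subset_eq[OF finf, of "A \<inter> f"] that c3 by simp
    have "G z \<inter> f = {}" if "card (N x y \<inter> f) = 3"
      using pair_in_U_full_edge[OF x y z xy f] full[OF that] by auto
    moreover have "card (N x y \<inter> f) \<noteq> 2" if "card (G z \<inter> f) = 3"
      using pair_in_U_adjacent_edge[OF x y z xy f] full[OF that] by auto
    ultimately show ?thesis using le3 by (cases "card (N x y \<inter> f) = 3") fastforce+
  qed
  have "(\<Sum>f\<in>M. card (N x y \<inter> f)) + (\<Sum>f\<in>M. card (G z \<inter> f)) \<le> 4 * card M"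
    using sum_bounded_above[of M "\<lambda>f. card (N x y \<inter> f) + card (G z \<inter> f)" 4] le4 by (simp add: sum.distrib)
  moreover have "card (N x y \<inter> U) = 0"
  proof -
    have "N x y \<inter> U = {}" using x y no_edge_in_U by (auto simp: pair_nbrs_def)
    then show ?thesis by simp
  qed
  moreover have "card (G z \<inter> U) \<le> card (U - {z})"
    using finite_U N_D by (intro card_mono) (auto simp: shadow_nbrs_def)
  moreover have "card (U - {z}) + 1 = card U"
    using z finite_U by (metis Suc_eq_plus1 card_Suc_Diff1)
  moreover have "2 * m \<le> card (N x y) + 1" using xy pair_degree by (auto simp: shadow_nbrs_def)
  moreover have "2 * m \<le> card (G z)" using z shadow_degree by (auto simp: U_def)
  ultimately show False
    using card_split[OF N_subset, of x y] card_split[OF G_subset, of z] card_U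
      \<open>3 \<le> card U\<close> by linarith
qed

section \<open>Every vertex is covered\<close>

text \<open>Three independent vertices of \<open>U\<close> send at least \<open>6 * m > 6 * card M\<close> shadow pairs into the matching
  edges, so some \<open>f\<close> receives 7 of them and its vertices can be matched with the three.\<close>

lemma U_empty: "U = {}"
proof (rule ccontr)
  assume "U \<noteq> {}"
  then have "0 < card U" using finite_U by (simp add: card_gt_0_iff)
  then have "3 \<le> card U" using card_U by presburger
  then obtain T where "T \<subseteq> U" "card T = 3" using obtain_subset_with_card_n by metis
  then obtain u v w where uvw: "u \<in> U" "v \<in> U" "w \<in> U" "u \<noteq> v" "u \<noteq> w" "v \<noteq> w"
    by (auto simp: card_3_iff)
  have G_sum: "2 * m \<le> (\<Sum>f\<in>M. card (G t \<inter> f))" if t: "t \<in> U" for t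
  proof -
    have "G t \<inter> U = {}" using U_independent[OF t] by blast
    moreover have "2 * m \<le> card (G t)" using t shadow_degree by (auto simp: U_def)
    ultimately show ?thesis using card_split[OF G_subset, of t] by simp
  qed
  have "\<exists>f\<in>M. 7 \<le> card (G u \<inter> f) + card (G v \<inter> f) + card (G w \<inter> f)"
  proof (rule ccontr)
    assume "\<not> ?thesis"
    then have "card (G u \<inter> f) + card (G v \<inter> f) + card (G w \<inter> f) \<le> 6" if "f \<in> M" for f
      using that by fastforce
    then have "(\<Sum>f\<in>M. card (G u \<inter> f)) + (\<Sum>f\<in>M. card (G v \<inter> f)) + (\<Sum>f\<in>M. card (G w \<inter> f))
        \<le> 6 * card M"
      using sum_bounded_above[of M "\<lambda>f. card (G u \<inter> f) + card (G v \<inter> f) + card (G w \<inter> f)" 6]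
      by (simp add: sum.distrib)
    then show False
      using G_sum[OF uvw(1)] G_sum[OF uvw(2)] G_sum[OF uvw(3)] card_U \<open>3 \<le> card U\<close> by linarith
  qed
  then obtain f where f: "f \<in> M"
    and seven: "7 \<le> card (G u \<inter> f) + card (G v \<inter> f) + card (G w \<inter> f)" by blast
  have "card f = 3" using f M_edges edge_card by blast
  from distinct_representatives_triple[OF this seven]
  obtain a b c where abc: "a \<in> G u" "b \<in> G v" "c \<in> G w" "f = {a, b, c}"
    "a \<noteq> b" "a \<noteq> c" "b \<noteq> c" by blast
  have fU: "f \<inter> U = {}" using f by (auto simp: U_def)
  have inner: "2 * card U + 3 \<le> card (N u a \<inter> (U \<union> f)) + card (N v b \<inter> (U \<union> f))
      + card (N w c \<inter> (U \<union> f))"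
  proof (rule three_pairs_inner_degree[OF f])
    show "distinct [u, a, v, b, w, c]" using uvw abc fU by auto
    show "{u, a, v, b, w, c} \<subseteq> U \<union> f" using uvw abc by auto
  qed (use abc in auto)
  have small: "card (N t s \<inter> (U \<union> f)) \<le> 2" if t: "t \<in> U" and s: "s \<in> f" for t s
  proof -
    have "N t s \<inter> (U \<union> f) \<subseteq> f - {s}"
    proof
      fix r assume r: "r \<in> N t s \<inter> (U \<union> f)"
      then have "r \<in> G t" using N_swap G_I by blast
      then have "r \<notin> U" using U_independent[OF t] by blast
      then show "r \<in> f - {s}" using r N_D by blast
    qed
    moreover have "finite f" "card (f - {s}) = 2"
      using \<open>card f = 3\<close> s by (auto intro: card_ge_0_finite)
    ultimately show ?thesis using card_mono[of "f - {s}"] by (metis finite_Diff)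
  qed
  show False
    using inner small[OF uvw(1), of a] small[OF uvw(2), of b] small[OF uvw(3), of c] abc(4)
      \<open>3 \<le> card U\<close> by fastforce
qed

end

section \<open>Perfect matchings from positive codegree\<close>

theorem theorem1p10:
  fixes V :: "'a set" and E :: "'a set set" and n :: nat
  assumes "three_graph V E"
    and "card V = n"
    and "3 dvd n"
    and "real (min_pos_codegree V E) \<ge> 2 * real n / 3 - 1"
    and "\<And>v. v \<in> V \<Longrightarrow> vertex_degree E v > 0"
  shows "\<exists>M. perfect_matching V E M"
proof -
  obtain m where n: "n = 3 * m" using assms(3) by blast
  have "finite E"
    using assms(1) finite_subset[of E "nsets V 3"] finite_imp_finite_nsets[of V 3]
    by (auto simp: three_graph_def)
  then have bound: "\<forall>M. matching E M \<longrightarrow> card M < Suc (card E)"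
    by (simp add: matching_def less_Suc_eq_le card_mono)
  have "matching E {}" by (simp add: matching_def)
  from ex_has_greatest_nat[OF this bound] obtain M
    where M: "matching E M" "\<And>M'. matching E M' \<Longrightarrow> card M' \<le> card M" by blast
  interpret maximum_matching V E m M
  proof
    show "\<exists>e\<in>E. v \<in> e" if "v \<in> V" for v
      using assms(5)[OF that] by (auto simp: vertex_degree_def card_gt_0_iff)
    show "2 * m \<le> card (pair_nbrs E x y) + 1" if "pair_nbrs E x y \<noteq> {}" for x y
      using min_pos_codegree_le_card_pair_nbrs[OF assms(1) that] assms(4) n by linarith
  qed (use assms(1,2) n M in simp_all)
  have "perfect_matching V E M"
    using U_empty M(1) by (auto simp: perfect_matching_def U_def)
  then show ?thesis by blast
qed

end
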